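(* Let $G=(V,E)$ be a graph without isolated vertices and $k$ a positive integer. Then there is a sequence of at most $k$ inclusive vertex splits transforming $G$ into a constellation if and only if there is a Star-decomposition $\mathcal{P}$ of $G$ with $\mathrm{wgt}(\mathcal{P})\le |V(G)|+k$.
   Context: All graphs are finite, simple and undirected. An inclusive vertex split of a vertex $v$ removes $v$ and adds two new vertices $v_1,v_2$ with $N(v_1)\cup N(v_2)=N(v)$ ($N(v_1)$ and $N(v_2)$ may intersect); no other adjacencies change. A star is a graph with a single central vertex adjacent to all other vertices; a constellation is a disjoint union of stars. A Star-decomposition of $G$ is a set $\mathcal{P}=\{H_1,\dots,H_l\}$ of subgraphs of $G$, each isomorphic to a star, whose edge sets partition $E(G)$; its weight is $\mathrm{wgt}(\mathcal{P})=\sum_{v\in V}|\{i: v\in V(H_i)\}|$. *)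

theory Defs
  imports "HOL-Library.Disjoint_Sets" "HOL-Library.Infinite_Typeclass"
begin

record 'a ugraph =
  verts :: "'a set"
  edges :: "'a set set"

definition simple_graph :: "'a ugraph \<Rightarrow> bool" where
  "simple_graph G \<longleftrightarrow> finite (verts G) \<and> (\<forall>e\<in>edges G. e \<subseteq> verts G \<and> card e = 2)"

definition nbhd :: "'a ugraph \<Rightarrow> 'a \<Rightarrow> 'a set" where
  "nbhd G v = {u. {u, v} \<in> edges G}"

definition subgraph :: "'a ugraph \<Rightarrow> 'a ugraph \<Rightarrow> bool" where
  "subgraph H G \<longleftrightarrow> simple_graph H \<and> verts H \<subseteq> verts G \<and> edges H \<subseteq> edges G"

definition no_isolated_vertices :: "'a ugraph \<Rightarrow> bool" where
  "no_isolated_vertices G \<longleftrightarrow> (\<forall>v\<in>verts G. nbhd G v \<noteq> {})"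

(* The relation only requires the two copies to be fresh, so it is useful on an infinite
   vertex universe. No edge joins v1 and v2, since nbhd G v contains neither of them. *)
definition inclusive_split :: "'a ugraph \<Rightarrow> 'a ugraph \<Rightarrow> bool" where
  "inclusive_split G G' \<longleftrightarrow> simple_graph G' \<and>
     (\<exists>v\<in>verts G. \<exists>v1 v2. v1 \<notin> verts G \<and> v2 \<notin> verts G \<and> v1 \<noteq> v2 \<and>
        verts G' = (verts G - {v}) \<union> {v1, v2} \<and>
        nbhd G' v1 \<union> nbhd G' v2 = nbhd G v \<and>
        (\<forall>x\<in>verts G - {v}. \<forall>y\<in>verts G - {v}. {x, y} \<in> edges G' \<longleftrightarrow> {x, y} \<in> edges G))"

(* The graph K_{1,m} for some m >= 0; the one-vertex graph counts as a star. The predicate is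
   invariant under isomorphism, so "isomorphic to a star" is the same as "star". *)
definition star :: "'a ugraph \<Rightarrow> bool" where
  "star H \<longleftrightarrow> simple_graph H \<and> (\<exists>c\<in>verts H. edges H = {{c, x} | x. x \<in> verts H - {c}})"

definition constellation :: "'a ugraph \<Rightarrow> bool" where
  "constellation G \<longleftrightarrow> simple_graph G \<and>
     (\<exists>S. (\<forall>H\<in>S. star H) \<and> disjoint_family_on verts S \<and>
          verts G = (\<Union>H\<in>S. verts H) \<and> edges G = (\<Union>H\<in>S. edges H))"

(* partition_on excludes empty blocks, so every member has at least one edge. *)
definition star_decomposition :: "'a ugraph \<Rightarrow> 'a ugraph set \<Rightarrow> bool" where
  "star_decomposition G P \<longleftrightarrow> finite P \<and> (\<forall>H\<in>P. subgraph H G \<and> star H) \<and>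
     inj_on edges P \<and> partition_on (edges G) (edges ` P)"

definition wgt :: "'a ugraph \<Rightarrow> 'a ugraph set \<Rightarrow> nat" where
  "wgt G P = (\<Sum>v\<in>verts G. card {H \<in> P. v \<in> verts H})"

end

theory Submission
  imports Defs
begin

text \<open>
  Reversing a split identifies its two copies again. Hence, up to isomorphism, the graphs reachable
  from \<open>G\<close> by \<open>n\<close> splits are the graphs \<open>H\<close> with \<open>card (verts G) + n\<close> vertices that have a map onto
  \<open>G\<close>, surjective on vertices and on edges. Given such a map from a constellation, keep one
  preimage of every edge of \<open>G\<close>; the images of the stars form a decomposition of weight at most
  \<open>card (verts H)\<close>. Conversely, the disjoint union of the members of a decomposition is a
  constellation which maps onto \<open>G\<close> and has as many vertices as the weight.
\<close>

section \<open>Images of graphs under vertex maps\<close>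

text \<open>A quotient when \<open>f\<close> is not injective: edges with equal images merge, and an
  edge whose ends are identified becomes a singleton, so the result may fail to be simple.\<close>

definition map_graph :: "('b \<Rightarrow> 'a) \<Rightarrow> 'b ugraph \<Rightarrow> 'a ugraph" where
  "map_graph f H = \<lparr>verts = f ` verts H, edges = (`) f ` edges H\<rparr>"

lemma verts_map_graph [simp]: "verts (map_graph f H) = f ` verts H"
  and edges_map_graph [simp]: "edges (map_graph f H) = (`) f ` edges H"
  by (simp_all add: map_graph_def)

lemma map_graph_id [simp]: "map_graph (\<lambda>x. x) H = H"
  by (simp add: map_graph_def)

lemma map_graph_comp: "map_graph f (map_graph g H) = map_graph (f \<circ> g) H"
  by (simp add: map_graph_def image_comp comp_def)

lemma simple_graph_edgeE:
  assumes "simple_graph G" "e \<in> edges G"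
  obtains x y where "e = {x, y}" "x \<noteq> y" "x \<in> verts G" "y \<in> verts G"
proof -
  from assms have "e \<subseteq> verts G" "card e = 2" by (auto simp: simple_graph_def)
  with that show thesis by (auto simp: card_2_iff)
qed

lemma simple_graph_edgeD:
  assumes "simple_graph G" "{x, y} \<in> edges G"
  shows "x \<noteq> y" "x \<in> verts G" "y \<in> verts G"
proof -
  from assms have "{x, y} \<subseteq> verts G" "card {x, y} = 2" by (auto simp: simple_graph_def)
  then show "x \<noteq> y" "x \<in> verts G" "y \<in> verts G" by auto
qed

text \<open>Equality of doubletons fixes the ends only up to order, but \<open>{p, q}\<close> can be
  read either way, so the preimage can be oriented to match \<open>x\<close> and
  \<open>y\<close>.\<close>

lemma edge_map_graph_iff:
  assumes "simple_graph H"
  shows "{x, y} \<in> edges (map_graph f H) \<longleftrightarrow> (\<exists>p q. {p, q} \<in> edges H \<and> f p = x \<and> f q = y)"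
    (is "?L \<longleftrightarrow> ?R")
proof
  assume ?L
  then obtain e where e: "e \<in> edges H" "f ` e = {x, y}" by auto
  with assms obtain p q where pq: "e = {p, q}" by (elim simple_graph_edgeE)
  with e have "f p = x \<and> f q = y \<or> f q = x \<and> f p = y" by (auto simp: doubleton_eq_iff)
  with e pq show ?R by (metis insert_commute)
next
  assume ?R
  then obtain p q where "{p, q} \<in> edges H" "{x, y} = f ` {p, q}" by auto
  then show ?L unfolding edges_map_graph by blast
qed

text \<open>The only obstruction to simplicity is an edge that collapses to a loop.\<close>

lemma simple_graph_map_graph_iff:
  assumes "simple_graph H"
  shows "simple_graph (map_graph f H) \<longleftrightarrow> (\<forall>p q. {p, q} \<in> edges H \<longrightarrow> f p \<noteq> f q)"
proof
  assume "simple_graph (map_graph f H)"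
  then show "\<forall>p q. {p, q} \<in> edges H \<longrightarrow> f p \<noteq> f q"
    by (metis assms edge_map_graph_iff simple_graph_edgeD(1))
next
  assume *: "\<forall>p q. {p, q} \<in> edges H \<longrightarrow> f p \<noteq> f q"
  have "f ` e \<subseteq> f ` verts H \<and> card (f ` e) = 2" if e: "e \<in> edges H" for e
  proof -
    obtain p q where pq: "e = {p, q}" "p \<in> verts H" "q \<in> verts H"
      using assms e by (elim simple_graph_edgeE)
    with * e have "f p \<noteq> f q" by auto
    with pq show ?thesis by auto
  qed
  with assms show "simple_graph (map_graph f H)"
    by (auto simp: simple_graph_def)
qed

lemma simple_graph_map_graph_inj:
  assumes "simple_graph H" "inj_on f (verts H)"
  shows "simple_graph (map_graph f H)"
  unfolding simple_graph_map_graph_iff[OF assms(1)]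
  using simple_graph_edgeD[OF assms(1)] assms(2) unfolding inj_on_def by blast

section \<open>Splits and surjections\<close>

text \<open>Sending both copies back to the split vertex and fixing all other vertices undoes the
  split. The covering condition on the two neighbourhoods says that this loses and creates no
  edge.\<close>

lemma inclusive_split_imp_map_graph:
  assumes G: "simple_graph G" and "inclusive_split G G'"
  shows "\<exists>f. G = map_graph f G' \<and> card (verts G') = Suc (card (verts G))"
proof -
  obtain v v1 v2 where G': "simple_graph G'" and v: "v \<in> verts G"
    and fresh: "v1 \<notin> verts G" "v2 \<notin> verts G" "v1 \<noteq> v2"
    and verts: "verts G' = (verts G - {v}) \<union> {v1, v2}"
    and nb: "nbhd G' v1 \<union> nbhd G' v2 = nbhd G v"
    and old: "\<And>x y. x \<in> verts G - {v} \<Longrightarrow> y \<in> verts G - {v} \<Longrightarrow>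
                {x, y} \<in> edges G' \<longleftrightarrow> {x, y} \<in> edges G"
    using assms unfolding inclusive_split_def by auto
  define f where "f = (\<lambda>x. if x = v1 \<or> x = v2 then v else x)"
  have nb': "{y, v} \<in> edges G \<longleftrightarrow> {y, v1} \<in> edges G' \<or> {y, v2} \<in> edges G'" for y
    using nb by (auto simp: nbhd_def)
  have fv: "f v1 = v" "f v2 = v" by (simp_all add: f_def)
  have V: "f ` verts G' = verts G"
    using v fresh by (auto simp: verts f_def)
  have edge: "{x, y} \<in> edges G \<longleftrightarrow> (\<exists>p q. {p, q} \<in> edges G' \<and> f p = x \<and> f q = y)" (is "_ \<longleftrightarrow> ?R") for x y
  proof
    assume xy: "{x, y} \<in> edges G"
    note D = simple_graph_edgeD[OF G xy]
    consider "x = v" | "y = v" | "x \<noteq> v" "y \<noteq> v" by blast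
    then show ?R
    proof cases
      case 1
      with xy nb'[of y] D fresh have "({v1, y} \<in> edges G' \<or> {v2, y} \<in> edges G') \<and> f y = y"
        by (auto simp: insert_commute f_def)
      with 1 fv show ?thesis by blast
    next
      case 2
      with xy nb'[of x] D fresh have "({x, v1} \<in> edges G' \<or> {x, v2} \<in> edges G') \<and> f x = x"
        by (auto simp: f_def)
      with 2 fv show ?thesis by blast
    next
      case 3
      with xy D old[of x y] fresh have "{x, y} \<in> edges G'" "f x = x" "f y = y"
        by (auto simp: f_def)
      then show ?thesis by blast
    qed
  next
    assume ?R
    then obtain p q where pq: "{p, q} \<in> edges G'" "f p = x" "f q = y" by blast
    note D = simple_graph_edgeD[OF G' pq(1)]
    \<comment> \<open>A neighbour of a copy is a neighbour of \<open>v\<close> in \<open>G\<close>,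
      hence an old vertex fixed by \<open>f\<close>; in particular the two copies are not
      adjacent.\<close>
    have *: "{a, v} \<in> edges G \<and> f a = a" if "{a, b} \<in> edges G'" "b = v1 \<or> b = v2" for a b
    proof -
      have "{a, v} \<in> edges G" using that nb' by auto
      with simple_graph_edgeD[OF G this] fresh show ?thesis by (auto simp: f_def)
    qed
    consider "p = v1 \<or> p = v2" | "q = v1 \<or> q = v2" | "p \<in> verts G - {v}" "q \<in> verts G - {v}"
      using D verts by auto
    then show "{x, y} \<in> edges G"
    proof cases
      case 1
      with *[of q p] pq show ?thesis by (auto simp: insert_commute f_def)
    next
      case 2
      with *[of p q] pq show ?thesis by (auto simp: f_def)
    next
      case 3
      with old[of p q] pq fresh show ?thesis by (auto simp: f_def)
    qed
  qed
  have "edges G = (`) f ` edges G'"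
  proof (intro equalityI subsetI)
    fix e assume e: "e \<in> edges G"
    with G obtain x y where "e = {x, y}" by (elim simple_graph_edgeE)
    with e edge have "e \<in> edges (map_graph f G')" by (simp only: edge_map_graph_iff[OF G'])
    then show "e \<in> (`) f ` edges G'" by simp
  next
    fix e assume "e \<in> (`) f ` edges G'"
    then obtain e' where e': "e' \<in> edges G'" "e = f ` e'" by blast
    with G' obtain p q where pq: "e' = {p, q}" by (elim simple_graph_edgeE)
    with e' edge have "{f p, f q} \<in> edges G" by blast
    with e' pq show "e \<in> edges G" by simp
  qed
  with V have "G = map_graph f G'" by (simp add: map_graph_def)
  moreover have "card (verts G') = Suc (card (verts G))"
  proof -
    have "finite (verts G)" "card (verts G) > 0" using G v by (auto simp: simple_graph_def card_gt_0_iff)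
    moreover have "card (verts G') = card (verts G - {v}) + 2"
      using fresh \<open>finite (verts G)\<close> by (auto simp: verts card_insert_if)
    ultimately show ?thesis using v by simp
  qed
  ultimately show ?thesis by blast
qed

lemma inclusive_splits_imp_map_graph:
  assumes "(inclusive_split ^^ n) G H" "simple_graph G"
  shows "\<exists>f. G = map_graph f H \<and> card (verts H) = card (verts G) + n"
  using assms
proof (induction n arbitrary: H)
  case 0
  then show ?case by (auto intro: exI[of _ "\<lambda>x. x"])
next
  case (Suc n)
  then obtain K where K: "(inclusive_split ^^ n) G K" "inclusive_split K H" by auto
  with Suc obtain f where f: "G = map_graph f K" "card (verts K) = card (verts G) + n" by blast
  \<comment> \<open>A split asserts simplicity of its result only, so \<open>n = 0\<close>, where
    \<open>K\<close> is \<open>G\<close>, relies on the hypothesis on \<open>G\<close>.\<close>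
  have "simple_graph K"
    using K Suc.prems(2) by (cases n) (auto simp: inclusive_split_def)
  with K(2) obtain g where "K = map_graph g H" "card (verts H) = Suc (card (verts K))"
    using inclusive_split_imp_map_graph by blast
  with f show ?case by (auto simp: map_graph_comp)
qed

text \<open>The surplus \<open>n\<close> measures how far \<open>f\<close> is from injective. While
  two vertices share an image \<open>v\<close>, a split of \<open>v\<close> separates one of them
  from the rest of its fibre and lowers the surplus by one. At surplus zero the map is injective, so
  the graph reached is a copy of \<open>H\<close>. The class \<open>infinite\<close> supplies the
  fresh vertices.\<close>

lemma map_graph_imp_inclusive_splits:
  fixes f :: "'b \<Rightarrow> 'a::infinite"
  assumes "simple_graph H" "simple_graph (map_graph f H)"
    and "card (verts H) = card (verts (map_graph f H)) + n"
  shows "\<exists>g. inj_on g (verts H) \<and> (inclusive_split ^^ n) (map_graph f H) (map_graph g H)"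
  using assms
proof (induction n arbitrary: f)
  case 0
  then have "inj_on f (verts H)" by (intro eq_card_imp_inj_on) (auto simp: simple_graph_def)
  then show ?case by auto
next
  case (Suc n)
  note H = \<open>simple_graph H\<close>
  have fin: "finite (verts H)" using H by (simp add: simple_graph_def)
  have ne: "f p \<noteq> f q" if "{p, q} \<in> edges H" for p q
    using Suc.prems that by (simp add: simple_graph_map_graph_iff)
  have "\<not> inj_on f (verts H)" using Suc.prems(3) by (auto dest: card_image)
  then obtain a b where ab: "a \<in> verts H" "b \<in> verts H" "a \<noteq> b" "f a = f b"
    by (auto simp: inj_on_def)
  define v where "v = f a"
  obtain v1 where v1: "v1 \<notin> f ` verts H" using fin ex_new_if_finite[OF infinite_UNIV] by blast
  obtain v2 where v2: "v2 \<notin> insert v1 (f ` verts H)"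
    using fin ex_new_if_finite[OF infinite_UNIV] by (metis finite_imageI finite_insert)
  \<comment> \<open>The vertex \<open>a\<close> gets the copy \<open>v1\<close> for itself; the rest
    of the fibre over \<open>v\<close> goes to \<open>v2\<close>.\<close>
  define f' where "f' = (\<lambda>x. if x = a then v1 else if f x = v then v2 else f x)"
  have f'_eq: "f' x = f' y \<Longrightarrow> f x = f y" if "x \<in> verts H" "y \<in> verts H" for x y
    using that v1 v2 by (auto simp: f'_def v_def split: if_splits)
  have f'_v1: "f' x = v1 \<longleftrightarrow> x = a" and f'_v2: "f' x = v2 \<longleftrightarrow> x \<noteq> a \<and> f x = v"
    and f'_old: "u \<in> verts (map_graph f H) - {v} \<Longrightarrow> f' x = u \<longleftrightarrow> f x = u"
    if "x \<in> verts H" for x u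
    using that v1 v2 by (auto simp: f'_def v_def)
  \<comment> \<open>Since \<open>f'\<close> refines \<open>f\<close>, it collapses no edge that
    \<open>f\<close> keeps.\<close>
  have simple': "simple_graph (map_graph f' H)"
    unfolding simple_graph_map_graph_iff[OF H]
    using ne f'_eq simple_graph_edgeD[OF H] by metis
  have V': "f' ` verts H = (f ` verts H - {v}) \<union> {v1, v2}"
  proof -
    \<comment> \<open>The copies are hit by \<open>a\<close> and \<open>b\<close>
      respectively.\<close>
    have "v1 \<in> f' ` verts H" "v2 \<in> f' ` verts H"
      using ab f'_v1 f'_v2 v_def by (metis image_eqI)+
    moreover have "u \<in> f' ` verts H" if "u \<in> f ` verts H - {v}" for u
      using that f'_old by (metis DiffE imageE image_eqI verts_map_graph)
    moreover have "f' x \<in> (f ` verts H - {v}) \<union> {v1, v2}" if "x \<in> verts H" for x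
      using that by (auto simp: f'_def)
    ultimately show ?thesis by blast
  qed
  have v: "v \<in> f ` verts H" using ab by (simp add: v_def)
  have card': "card (verts H) = card (verts (map_graph f' H)) + n"
  proof -
    have "card (f' ` verts H) = card (f ` verts H - {v}) + 2"
      using fin v1 v2 by (auto simp: V' card_insert_if)
    moreover have "card (f ` verts H) > 0" using fin v by (auto simp: card_gt_0_iff)
    ultimately show ?thesis using Suc.prems(3) fin v by simp
  qed
  \<comment> \<open>No edge of \<open>H\<close> lies within a fibre of \<open>f\<close>, so a
    neighbour of the fibre over \<open>v\<close> lies outside it, where both maps agree.\<close>
  have f'_nb: "f' p = f p" if "{p, q} \<in> edges H" "f q = v" for p q
  proof -
    have "p \<noteq> a" "f p \<noteq> v" using ne[OF that(1)] that(2) by (auto simp: v_def)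
    then show ?thesis by (simp add: f'_def)
  qed
  have V: "p \<in> verts H" "q \<in> verts H" if "{p, q} \<in> edges H" for p q
    using simple_graph_edgeD[OF H that] by auto
  have copies: "f q = v \<longleftrightarrow> f' q = v1 \<or> f' q = v2" if "q \<in> verts H" for q
    using that f'_v1 f'_v2 v_def by auto
  have nb: "nbhd (map_graph f' H) v1 \<union> nbhd (map_graph f' H) v2 = nbhd (map_graph f H) v"
  proof -
    have "(\<exists>p q. {p, q} \<in> edges H \<and> f' p = u \<and> (f' q = v1 \<or> f' q = v2)) \<longleftrightarrow>
          (\<exists>p q. {p, q} \<in> edges H \<and> f p = u \<and> f q = v)" for u
      using f'_nb V copies by metis
    then show ?thesis
      unfolding nbhd_def edge_map_graph_iff[OF H] by blast
  qed
  have old: "{x, y} \<in> edges (map_graph f' H) \<longleftrightarrow> {x, y} \<in> edges (map_graph f H)"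
    if "x \<in> verts (map_graph f H) - {v}" "y \<in> verts (map_graph f H) - {v}" for x y
    unfolding edge_map_graph_iff[OF H] using f'_old[OF _ that(1)] f'_old[OF _ that(2)] V by metis
  have "\<exists>v1 v2. v1 \<notin> verts (map_graph f H) \<and> v2 \<notin> verts (map_graph f H) \<and> v1 \<noteq> v2 \<and>
      verts (map_graph f' H) = (verts (map_graph f H) - {v}) \<union> {v1, v2} \<and>
      nbhd (map_graph f' H) v1 \<union> nbhd (map_graph f' H) v2 = nbhd (map_graph f H) v \<and>
      (\<forall>x\<in>verts (map_graph f H) - {v}. \<forall>y\<in>verts (map_graph f H) - {v}.
         {x, y} \<in> edges (map_graph f' H) \<longleftrightarrow> {x, y} \<in> edges (map_graph f H))"
  proof (rule exI[of _ v1], rule exI[of _ v2], intro conjI ballI)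
    show "verts (map_graph f' H) = (verts (map_graph f H) - {v}) \<union> {v1, v2}"
      using V' by simp
    show "v1 \<notin> verts (map_graph f H)" "v2 \<notin> verts (map_graph f H)" "v1 \<noteq> v2"
      using v1 v2 by auto
  qed (fact nb, fact old)
  then have "inclusive_split (map_graph f H) (map_graph f' H)"
    using simple' v unfolding inclusive_split_def verts_map_graph by blast
  moreover obtain g where "inj_on g (verts H)" "(inclusive_split ^^ n) (map_graph f' H) (map_graph g H)"
    using Suc.IH[OF H simple' card'] by blast
  ultimately show ?case by (meson relpowp_Suc_I2)
qed

section \<open>Stars and decompositions\<close>

lemma star_map_graph_inj:
  assumes "star H" "inj_on f (verts H)"
  shows "star (map_graph f H)"
proof -
  obtain c where c: "c \<in> verts H" "edges H = {{c, x} | x. x \<in> verts H - {c}}"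
    and H: "simple_graph H" using assms by (auto simp: star_def)
  have "f ` verts H - {f c} = f ` (verts H - {c})"
    using assms(2) c(1) by (auto simp: inj_on_def)
  moreover have "edges H = (\<lambda>x. {c, x}) ` (verts H - {c})"
    using c(2) by blast
  ultimately have "edges (map_graph f H) = (\<lambda>x. {f c, x}) ` (verts (map_graph f H) - {f c})"
    by (simp add: image_image)
  also have "\<dots> = {{f c, x} | x. x \<in> verts (map_graph f H) - {f c}}"
    by blast
  finally have "edges (map_graph f H) = {{f c, x} | x. x \<in> verts (map_graph f H) - {f c}}" .
  moreover have "f c \<in> verts (map_graph f H)" using c(1) by simp
  ultimately show ?thesis
    unfolding star_def using simple_graph_map_graph_inj[OF H assms(2)] by blast
qed

text \<open>Each vertex other than \<open>c\<close> lies in some edge of \<open>T\<close>, whose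
  other end must be \<open>c\<close>. Nonemptiness of \<open>T\<close> makes \<open>c\<close> itself
  a vertex.\<close>

lemma star_of_edges:
  assumes "finite T" "T \<noteq> {}" "\<And>e. e \<in> T \<Longrightarrow> c \<in> e \<and> card e = 2"
  shows "star \<lparr>verts = \<Union>T, edges = T\<rparr>"
proof -
  have "finite e" if "e \<in> T" for e using assms(3)[OF that] by (metis card.infinite zero_neq_numeral)
  then have simple: "simple_graph \<lparr>verts = \<Union>T, edges = T\<rparr>"
    using assms by (auto simp: simple_graph_def)
  have form: "\<exists>x. x \<noteq> c \<and> e = {c, x}" if "e \<in> T" for e
    using assms(3)[OF that] by (auto simp: card_2_iff)
  have "T = {{c, x} | x. x \<in> \<Union>T - {c}}"
  proof (intro equalityI subsetI)
    fix e assume e: "e \<in> T"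
    then obtain x where "x \<noteq> c" "e = {c, x}" using form by blast
    with e show "e \<in> {{c, x} | x. x \<in> \<Union>T - {c}}" by blast
  next
    fix e assume "e \<in> {{c, x} | x. x \<in> \<Union>T - {c}}"
    then obtain x e' where "e = {c, x}" "x \<noteq> c" "x \<in> e'" "e' \<in> T" by blast
    with form[of e'] show "e \<in> T" by auto
  qed
  moreover have "c \<in> \<Union>T" using assms by blast
  ultimately show ?thesis
    unfolding star_def ugraph.simps using simple by (intro conjI bexI[of _ c])
qed

text \<open>Needed because splitting ends in an injective image of the constructed constellation,
  over the vertex type of \<open>G\<close>. Injectivity keeps the stars disjoint.\<close>

lemma constellation_map_graph_inj:
  assumes "constellation H" "inj_on f (verts H)"
  shows "constellation (map_graph f H)"
proof -
  obtain S where S: "\<forall>K\<in>S. star K" "disjoint_family_on verts S"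
    "verts H = (\<Union>K\<in>S. verts K)" "edges H = (\<Union>K\<in>S. edges K)"
    and H: "simple_graph H" using assms by (auto simp: constellation_def)
  have inj: "inj_on f (verts K)" if "K \<in> S" for K
    using assms(2) S(3) that by (auto intro: inj_on_subset)
  have "disjoint_family_on verts (map_graph f ` S)"
    unfolding disjoint_family_on_def
  proof (intro ballI impI, elim imageE)
    fix A B K L assume *: "A \<noteq> B" "A = map_graph f K" "K \<in> S" "B = map_graph f L" "L \<in> S"
    then have "K \<noteq> L" by blast
    with * have "verts K \<inter> verts L = {}" using S(2) by (simp add: disjoint_family_on_def)
    moreover have "verts K \<subseteq> verts H" "verts L \<subseteq> verts H" using * S(3) by auto
    ultimately show "verts A \<inter> verts B = {}"
      using * inj_on_image_Int[OF assms(2), of "verts K" "verts L"] by simp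
  qed
  moreover have "\<forall>K\<in>map_graph f ` S. star K" using S(1) inj star_map_graph_inj by blast
  ultimately show ?thesis unfolding constellation_def
    using simple_graph_map_graph_inj[OF H assms(2)] S(3,4)
    by (intro conjI exI[of _ "map_graph f ` S"]) auto
qed

section \<open>Weights, and the passage between constellations and decompositions\<close>

text \<open>Double counting of the incidences between vertices and members of
  \<open>P\<close>.\<close>

lemma wgt_eq_sum_card_verts:
  assumes "finite (verts G)" "finite P" "\<And>K. K \<in> P \<Longrightarrow> verts K \<subseteq> verts G"
  shows "wgt G P = (\<Sum>K\<in>P. card (verts K))"
proof -
  have "wgt G P = (\<Sum>v\<in>verts G. \<Sum>K\<in>P. if v \<in> verts K then 1 else 0)"
    unfolding wgt_def by (simp only: card_eq_sum sum.inter_filter[OF assms(2)])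
  also have "\<dots> = (\<Sum>K\<in>P. \<Sum>v\<in>verts G. if v \<in> verts K then 1 else 0)"
    by (rule sum.swap)
  also have "\<dots> = (\<Sum>K\<in>P. card (verts K))"
  proof (rule sum.cong)
    fix K assume "K \<in> P"
    then have "verts G \<inter> {v. v \<in> verts K} = verts K" using assms(3) by blast
    then show "(\<Sum>v\<in>verts G. if v \<in> verts K then 1 else 0) = card (verts K)"
      using assms(1) by (simp add: sum.If_cases)
  qed simp
  finally show ?thesis .
qed

text \<open>The edges whose chosen preimages lie in one star \<open>K\<close> all pass through the
  image of its centre, so they form a star on vertices from the image of \<open>K\<close>. Hence
  each new star has at most as many vertices as \<open>K\<close>, and the disjoint stars
  \<open>K\<close> together have \<open>card (verts H)\<close> vertices.\<close>

lemma constellation_imp_star_decomposition: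
  fixes H :: "'b ugraph" and f :: "'b \<Rightarrow> 'a"
  assumes "constellation H" and G: "simple_graph (map_graph f H)"
  shows "\<exists>P. star_decomposition (map_graph f H) P \<and> wgt (map_graph f H) P \<le> card (verts H)"
proof -
  obtain S where star: "\<And>K. K \<in> S \<Longrightarrow> star K" and disj: "disjoint_family_on verts S"
    and verts: "verts H = (\<Union>K\<in>S. verts K)" and edges: "edges H = (\<Union>K\<in>S. edges K)"
    and H: "simple_graph H" using assms(1) by (auto simp: constellation_def)
  let ?G = "map_graph f H"
  have finV: "finite (verts H)" using H by (simp add: simple_graph_def)
  have "edges H \<subseteq> Pow (verts H)" using H by (auto simp: simple_graph_def)
  then have finE: "finite (edges ?G)"
    using finV by (simp add: finite_subset[of _ "Pow (verts H)"])
  have "\<forall>e\<in>edges ?G. \<exists>e'. e' \<in> edges H \<and> f ` e' = e"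
    unfolding edges_map_graph by blast
  \<comment> \<open>Several edges of \<open>H\<close> may have the same image; choosing one preimage
    per edge is what makes the sets \<open>T K\<close> below disjoint.\<close>
  then obtain g where g: "\<And>e. e \<in> edges ?G \<Longrightarrow> g e \<in> edges H \<and> f ` g e = e"
    by metis
  define T where "T = (\<lambda>K :: 'b ugraph. {e \<in> edges ?G. g e \<in> edges K})"
  define h where "h = (\<lambda>K :: 'b ugraph. \<lparr>verts = \<Union>(T K), edges = T K\<rparr>)"
  \<comment> \<open>Stars from which no edge was chosen would give empty blocks and are
    dropped.\<close>
  define S' where "S' = {K \<in> S. T K \<noteq> {}}"
  define P where "P = h ` S'"
  have edge_verts: "e \<subseteq> verts K \<and> e \<noteq> {}" if "K \<in> S" "e \<in> edges K" for K e
  proof -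
    have "simple_graph K" using star[OF that(1)] by (simp add: star_def)
    then have "e \<subseteq> verts K" "card e = 2" using that(2) by (auto simp: simple_graph_def)
    then show ?thesis by auto
  qed
  have S_inj: "K = L" if "K \<in> S" "L \<in> S" "x \<in> verts K" "x \<in> verts L" for K L x
    using disj that unfolding disjoint_family_on_def by blast
  \<comment> \<open>The nonempty edge \<open>g e\<close> would lie in both stars, which are disjoint
    unless equal.\<close>
  have T_inj: "K = L" if "K \<in> S" "L \<in> S" "e \<in> T K" "e \<in> T L" for K L e
  proof -
    have "g e \<in> edges K" "g e \<in> edges L" using that(3,4) by (simp_all add: T_def)
    then have "g e \<subseteq> verts K" "g e \<subseteq> verts L" "g e \<noteq> {}"
      using edge_verts that(1,2) by auto
    then show ?thesis using S_inj[OF that(1,2)] by blast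
  qed
  \<comment> \<open>Every star contains its centre, so distinct members of the disjoint family have
    distinct vertex sets within the finite \<open>verts H\<close>.\<close>
  have finS: "finite S"
  proof (rule inj_on_finite)
    show "inj_on verts S"
    proof (rule inj_onI)
      fix K L assume *: "K \<in> S" "L \<in> S" "verts K = verts L"
      then obtain c where "c \<in> verts K" using star[of K] unfolding star_def by blast
      with * show "K = L" using S_inj by auto
    qed
    show "verts ` S \<subseteq> Pow (verts H)" using verts by blast
    show "finite (Pow (verts H))" using finV by simp
  qed
  then have finS': "finite S'" and finP: "finite P" by (auto simp: S'_def P_def)
  have star_h: "star (h K)" if K: "K \<in> S'" for K
  proof -
    have "K \<in> S" using K by (simp add: S'_def)
    then obtain c where c: "edges K = {{c, x} | x. x \<in> verts K - {c}}"
      using star[of K] unfolding star_def by blast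
    show ?thesis unfolding h_def
    proof (rule star_of_edges)
      show "finite (T K)" using finE by (simp add: T_def)
      show "T K \<noteq> {}" using K by (simp add: S'_def)
      fix e assume e: "e \<in> T K"
      then have "c \<in> g e" using c by (auto simp: T_def)
      moreover have "card e = 2" using e G unfolding T_def simple_graph_def by blast
      moreover have "f ` g e = e" using e g unfolding T_def by blast
      ultimately show "f c \<in> e \<and> card e = 2" by blast
    qed
  qed
  have verts_h: "verts (h K) \<subseteq> f ` verts K" if "K \<in> S" for K
  proof
    fix x assume "x \<in> verts (h K)"
    then obtain e where e: "e \<in> edges ?G" "g e \<in> edges K" "x \<in> e" unfolding h_def T_def ugraph.simps by blast
    then have "x \<in> f ` g e" using g by simp
    with edge_verts[OF that e(2)] show "x \<in> f ` verts K" by blast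
  qed
  have verts_P: "verts K \<subseteq> verts ?G" if K: "K \<in> P" for K
    proof -
    obtain L where "L \<in> S" "K = h L" using K by (auto simp: P_def S'_def)
    then have "verts K \<subseteq> f ` verts L" "verts L \<subseteq> verts H" using verts_h[of L] verts by auto
    then show ?thesis unfolding verts_map_graph by blast
  qed
  have "star_decomposition ?G P"
    unfolding star_decomposition_def
  proof (intro conjI ballI)
    fix K assume "K \<in> P"
    then show "star K" using star_h by (auto simp: P_def)
    then show "subgraph K ?G"
      using \<open>K \<in> P\<close> verts_P[of K] unfolding subgraph_def star_def by (auto simp: P_def h_def T_def)
  next
    \<comment> \<open>The vertex set of a member of \<open>P\<close> is the union of its edges, so
      the edges determine the member.\<close>
    show "inj_on edges P" by (auto simp: inj_on_def P_def h_def)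
    show "partition_on (edges ?G) (edges ` P)"
    proof (rule partition_onI)
      show "\<Union>(edges ` P) = edges ?G"
      proof (intro equalityI subsetI)
        fix e assume e: "e \<in> edges ?G"
        with g edges obtain K where "K \<in> S" "g e \<in> edges K" by blast
        then have "K \<in> S" "e \<in> T K" using e unfolding T_def by blast+
        then show "e \<in> \<Union>(edges ` P)" by (auto simp: P_def S'_def h_def)
      qed (auto simp: P_def h_def T_def)
    next
      fix p q assume pq: "p \<in> edges ` P" "q \<in> edges ` P" "p \<noteq> q"
      have "edges ` P = T ` S'" by (simp add: P_def h_def image_image)
      with pq have "p \<in> T ` S'" "q \<in> T ` S'" by simp_all
      then obtain K L where KL: "p = T K" "K \<in> S'" "q = T L" "L \<in> S'" by (elim imageE)
      have "K \<noteq> L" using pq KL by auto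
      moreover have "K \<in> S" "L \<in> S" using KL by (simp_all add: S'_def)
      ultimately have "T K \<inter> T L = {}" using T_inj[of K L] by blast
      then show "disjnt p q" using KL by (simp add: disjnt_def)
    next
      show "{} \<notin> edges ` P" by (auto simp: P_def h_def S'_def)
    qed
  qed (fact finP)
  moreover have "wgt ?G P \<le> card (verts H)"
  proof -
    have finK: "finite (verts K)" if "K \<in> S" for K
      using star[OF that] by (simp add: star_def simple_graph_def)
    have "wgt ?G P = (\<Sum>K\<in>P. card (verts K))"
      using finV finP verts_P by (intro wgt_eq_sum_card_verts) auto
    also have "\<dots> \<le> (\<Sum>K\<in>S'. card (verts (h K)))"
      unfolding P_def using sum_image_le[OF finS', of "\<lambda>K. card (verts K)" h] by simp
    also have "\<dots> \<le> (\<Sum>K\<in>S'. card (verts K))"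
      using verts_h finK by (intro sum_mono surj_card_le[where f = f]) (simp_all add: S'_def)
    also have "\<dots> \<le> (\<Sum>K\<in>S. card (verts K))"
      using finS by (intro sum_mono2) (auto simp: S'_def)
    also have "\<dots> = card (verts H)"
      using disj finS finK unfolding verts disjoint_family_on_def
      by (intro card_UN_disjoint[symmetric]) auto
    finally show ?thesis .
  qed
  ultimately show ?thesis by blast
qed

text \<open>Pairing every vertex with the star that contains it makes the stars disjoint, and
  \<open>fst\<close> glues them back together. A vertex of \<open>G\<close> then occurs once for
  each member of \<open>P\<close> through it, which is how the weight counts it.\<close>

lemma star_decomposition_imp_constellation:
  fixes G :: "'a ugraph"
  assumes G: "simple_graph G" and "no_isolated_vertices G" and P: "star_decomposition G P"
  shows "\<exists>H :: ('a \<times> 'a ugraph) ugraph.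
           constellation H \<and> map_graph fst H = G \<and> card (verts H) = wgt G P"
proof -
  define tag where "tag = (\<lambda>K :: 'a ugraph. map_graph (\<lambda>x. (x, K)) K)"
  define H where "H = \<lparr>verts = (\<Union>K\<in>P. verts (tag K)), edges = (\<Union>K\<in>P. edges (tag K))\<rparr>"
  have finP: "finite P" and sub: "\<And>K. K \<in> P \<Longrightarrow> verts K \<subseteq> verts G" and star: "\<And>K. K \<in> P \<Longrightarrow> star K"
    and edges: "edges G = (\<Union>K\<in>P. edges K)"
    using P by (auto simp: star_decomposition_def partition_on_def subgraph_def)
  have star_tag: "star (tag K)" if "K \<in> P" for K
    unfolding tag_def using star[OF that] by (intro star_map_graph_inj) (auto simp: inj_on_def)
  then have simple_tag: "simple_graph (tag K)" if "K \<in> P" for K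
    using that by (simp add: star_def)
  then have "simple_graph H"
    using finP by (fastforce simp: simple_graph_def H_def)
  moreover have "disjoint_family_on verts (tag ` P)"
    by (auto simp: disjoint_family_on_def tag_def)
  ultimately have "constellation H"
    unfolding constellation_def
    using star_tag by (intro conjI exI[of _ "tag ` P"]) (auto simp: H_def)
  moreover have "map_graph fst H = G"
  proof -
    have tag: "map_graph fst (tag K) = K" for K
      by (simp add: tag_def map_graph_comp comp_def)
    have "edges (map_graph fst H) = (\<Union>K\<in>P. edges (map_graph fst (tag K)))"
      by (simp add: H_def image_UN)
    then have E: "edges (map_graph fst H) = edges G" by (simp only: tag edges)
    have "verts (map_graph fst H) = (\<Union>K\<in>P. verts (map_graph fst (tag K)))"
      by (simp add: H_def image_UN)
    also have "\<dots> = (\<Union>K\<in>P. verts K)" by (simp only: tag)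
    also have "\<dots> = verts G"
    proof (intro equalityI subsetI)
      \<comment> \<open>Without isolated vertices, \<open>v\<close> lies on an edge and hence in the
        member of \<open>P\<close> that carries this edge; this makes \<open>fst\<close> surjective
        onto \<open>verts G\<close>.\<close>
      fix v assume "v \<in> verts G"
      with assms(2) obtain u where "{u, v} \<in> edges G"
        by (auto simp: no_isolated_vertices_def nbhd_def)
      then obtain K where K: "K \<in> P" "{u, v} \<in> edges K" using edges by blast
      have "simple_graph K" using star[OF K(1)] by (simp add: star_def)
      with K show "v \<in> (\<Union>K\<in>P. verts K)" using simple_graph_edgeD(3)[of K u v] by blast
    qed (use sub in blast)
    finally show ?thesis using E by (simp add: map_graph_def)
  qed
  moreover have "card (verts H) = wgt G P"
  proof -
    have fin: "finite (verts (tag K))" if "K \<in> P" for K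
      using simple_tag[OF that] by (simp add: simple_graph_def)
    have "card (verts H) = (\<Sum>K\<in>P. card (verts (tag K)))"
      using finP fin by (simp add: H_def) (intro card_UN_disjoint, auto simp: tag_def)
    also have "\<dots> = (\<Sum>K\<in>P. card (verts K))"
      by (simp add: tag_def card_image inj_on_def)
    also have "\<dots> = wgt G P"
      using G finP sub by (intro wgt_eq_sum_card_verts[symmetric]) (simp_all add: simple_graph_def)
    finally show ?thesis .
  qed
  ultimately show ?thesis by blast
qed

theorem theorem2:
  fixes G :: "'a::infinite ugraph" and k :: nat
  assumes "simple_graph G"
    and "no_isolated_vertices G"
    and "k > 0"
  shows "(\<exists>n\<le>k. \<exists>H. (inclusive_split ^^ n) G H \<and> constellation H) \<longleftrightarrow>
         (\<exists>P. star_decomposition G P \<and> wgt G P \<le> card (verts G) + k)"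
proof
  assume "\<exists>n\<le>k. \<exists>H. (inclusive_split ^^ n) G H \<and> constellation H"
  then obtain n H where n: "n \<le> k" "(inclusive_split ^^ n) G H" "constellation H" by blast
  with assms(1) obtain f where "G = map_graph f H" "card (verts H) = card (verts G) + n"
    using inclusive_splits_imp_map_graph by blast
  with constellation_imp_star_decomposition[OF n(3), of f] assms(1) n(1)
  show "\<exists>P. star_decomposition G P \<and> wgt G P \<le> card (verts G) + k" by fastforce
next
  assume "\<exists>P. star_decomposition G P \<and> wgt G P \<le> card (verts G) + k"
  then obtain P where P: "star_decomposition G P" "wgt G P \<le> card (verts G) + k" by blast
  with assms obtain H :: "('a \<times> 'a ugraph) ugraph" where
    H: "constellation H" "map_graph fst H = G" "card (verts H) = wgt G P"
    using star_decomposition_imp_constellation by blast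
  have simple: "simple_graph H" using H(1) by (simp add: constellation_def)
  \<comment> \<open>Surjectivity of \<open>fst\<close> makes the surplus \<open>n\<close> a natural
    number; the weight bound then gives \<open>n \<le> k\<close>.\<close>
  have "card (verts G) \<le> card (verts H)"
    using simple by (auto simp flip: H(2) simp: simple_graph_def intro: card_image_le)
  then obtain n where n: "card (verts H) = card (verts G) + n" using le_Suc_ex by blast
  then obtain g where "inj_on g (verts H)" "(inclusive_split ^^ n) G (map_graph g H)"
    using map_graph_imp_inclusive_splits[OF simple, of fst n] assms(1) H(2) by auto
  \<comment> \<open>The witness is \<open>map_graph g H\<close>, since \<open>H\<close> itself lives
    on pairs.\<close>
  then show "\<exists>n\<le>k. \<exists>H. (inclusive_split ^^ n) G H \<and> constellation H"
    using constellation_map_graph_inj[OF H(1)] n H(3) P(2) by (metis add_le_cancel_left)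
qed

end
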